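(* There exists a finite planar graph $G''$ whose hat guessing number satisfies $\mathrm{HG}(G'')\geq 14$.
   Context: Hat guessing game: sages sit at the vertices of a finite simple graph $G$ (the visibility graph). Each sage $v$ receives a hat whose color is one of $k$ colors, and sees only the hat colors of the sages at adjacent vertices (not his own). The sages do not communicate; beforehand they fix a deterministic strategy, i.e. for each vertex $v$ a function from the colorings of the neighbors of $v$ to a guess for the color of $v$'s own hat. The strategy is winning if for every assignment of colors to all vertices at least one sage guesses his own color correctly. The hat guessing number $\mathrm{HG}(G)$ is the largest $k$ for which the sages have a winning strategy. *)

theory Defs
  imports "HOL-Analysis.Analysis" "Graph_Theory.Pair_Digraph"
begin

text \<open>
  A finite simple graph is a \<^term>\<open>pair_graph\<close>: finite, loop-free, with a symmetric set of arcs.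
  An undirected edge corresponds to the two arcs \<open>(u, v)\<close> and \<open>(v, u)\<close>.
\<close>

section \<open>Planarity\<close>

text \<open>
  The curve family \<open>\<gamma>\<close> is indexed by the unordered pair \<open>{u, v}\<close>, so the two arcs of an edge share
  one curve. The library predicate \<^const>\<open>arc\<close> denotes an injective continuous path.
\<close>

definition plane_drawing ::
  "'a pair_pre_digraph \<Rightarrow> ('a \<Rightarrow> complex) \<Rightarrow> ('a set \<Rightarrow> real \<Rightarrow> complex) \<Rightarrow> bool" where
  "plane_drawing G p \<gamma> \<longleftrightarrow>
     inj_on p (pverts G) \<and>
     (\<forall>(u, v) \<in> parcs G.
        arc (\<gamma> {u, v}) \<and>
        {pathstart (\<gamma> {u, v}), pathfinish (\<gamma> {u, v})} = {p u, p v} \<and>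
        path_image (\<gamma> {u, v}) \<inter> p ` pverts G = {p u, p v}) \<and>
     (\<forall>(u, v) \<in> parcs G. \<forall>(x, y) \<in> parcs G. {u, v} \<noteq> {x, y} \<longrightarrow>
        path_image (\<gamma> {u, v}) \<inter> path_image (\<gamma> {x, y}) \<subseteq> p ` ({u, v} \<inter> {x, y}))"

definition planar :: "'a pair_pre_digraph \<Rightarrow> bool" where
  "planar G \<longleftrightarrow> (\<exists>p \<gamma>. plane_drawing G p \<gamma>)"

section \<open>The hat guessing game\<close>

definition neighbors :: "'a pair_pre_digraph \<Rightarrow> 'a \<Rightarrow> 'a set" where
  "neighbors G v = {u. (v, u) \<in> parcs G}"

abbreviation colorings :: "nat \<Rightarrow> 'a set \<Rightarrow> ('a \<Rightarrow> nat) set" where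
  "colorings k A \<equiv> A \<rightarrow>\<^sub>E {..<k}"

definition strategy :: "'a pair_pre_digraph \<Rightarrow> nat \<Rightarrow> ('a \<Rightarrow> ('a \<Rightarrow> nat) \<Rightarrow> nat) \<Rightarrow> bool" where
  "strategy G k g \<longleftrightarrow> (\<forall>v \<in> pverts G. g v \<in> colorings k (neighbors G v) \<rightarrow> {..<k})"

definition winning_strategy ::
  "'a pair_pre_digraph \<Rightarrow> nat \<Rightarrow> ('a \<Rightarrow> ('a \<Rightarrow> nat) \<Rightarrow> nat) \<Rightarrow> bool" where
  "winning_strategy G k g \<longleftrightarrow> strategy G k g \<and>
     (\<forall>c \<in> colorings k (pverts G). \<exists>v \<in> pverts G. g v (restrict c (neighbors G v)) = c v)"

definition sages_win :: "'a pair_pre_digraph \<Rightarrow> nat \<Rightarrow> bool" where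
  "sages_win G k \<longleftrightarrow> (\<exists>g. winning_strategy G k g)"

text \<open>
  For a finite nonempty graph the supremum below is a maximum, by
  \<open>sages_win_hat_guessing_number\<close>. For the null graph it is 0.
\<close>

definition hat_guessing_number :: "'a pair_pre_digraph \<Rightarrow> nat" where
  "hat_guessing_number G = Sup {k. sages_win G k}"

lemma sages_win_le_card:
  assumes G: "pair_graph G" and win: "sages_win G k"
  shows "k \<le> card (pverts G)"
proof (cases "k = 0")
  case False
  interpret pair_graph G by fact
  let ?V = "pverts G"
  let ?C = "colorings k ?V"
  have fin: "finite ?V" by (rule pair_finite_verts)
  obtain g where g: "\<And>c. c \<in> ?C \<Longrightarrow> \<exists>v \<in> ?V. g v (restrict c (neighbors G v)) = c v"
    using win unfolding sages_win_def winning_strategy_def by blast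
  define A where "A v = {c \<in> ?C. g v (restrict c (neighbors G v)) = c v}" for v
  have finC: "finite ?C" using fin by (simp add: finite_PiE)
  have cardA: "card (A v) \<le> k ^ (card ?V - 1)" if v: "v \<in> ?V" for v
  proof -
    let ?r = "\<lambda>c. restrict c (?V - {v})"
    have "inj_on ?r (A v)"
    proof (rule inj_onI)
      fix c d assume c: "c \<in> A v" and d: "d \<in> A v" and eq: "?r c = ?r d"
      have off: "c x = d x" if "x \<noteq> v" for x
      proof (cases "x \<in> ?V")
        case True
        then show ?thesis using fun_cong[OF eq, of x] that by simp
      next
        case False
        moreover have "c \<in> ?C" "d \<in> ?C" using c d unfolding A_def by blast+
        ultimately show ?thesis by (metis PiE_arb)
      qed
      have "v \<notin> neighbors G v" using pair_no_loops[of "(v, v)"] unfolding neighbors_def by auto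
      then have "restrict c (neighbors G v) = restrict d (neighbors G v)"
        using off by (intro restrict_ext) metis
      then have "c v = d v" using c d unfolding A_def by simp
      with off show "c = d" by (intro ext) metis
    qed
    moreover have "?r ` A v \<subseteq> colorings k (?V - {v})"
      unfolding A_def by (auto simp: PiE_iff extensional_def split: if_splits)
    ultimately have "card (A v) \<le> card (colorings k (?V - {v}))"
      using fin by (intro card_inj_on_le) (auto intro: finite_PiE)
    also have "\<dots> = k ^ (card ?V - 1)" using fin v by (simp add: card_PiE)
    finally show ?thesis .
  qed
  have "?C \<noteq> {}" using False by (simp add: PiE_eq_empty_iff lessThan_empty_iff)
  then have ne: "?V \<noteq> {}" using g by blast
  have "?C \<subseteq> (\<Union>v \<in> ?V. A v)" using g unfolding A_def by blast
  moreover have "finite (\<Union>v \<in> ?V. A v)" using fin finC unfolding A_def by auto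
  ultimately have "card ?C \<le> card (\<Union>v \<in> ?V. A v)" by (rule card_mono[rotated])
  also have "\<dots> \<le> (\<Sum>v \<in> ?V. card (A v))" using fin by (rule card_UN_le)
  also have "\<dots> \<le> card ?V * k ^ (card ?V - 1)"
    using sum_bounded_above[of ?V "\<lambda>v. card (A v)" "k ^ (card ?V - 1)"] cardA by simp
  finally have "k ^ card ?V \<le> card ?V * k ^ (card ?V - 1)" using fin by (simp add: card_PiE)
  moreover have "k ^ card ?V = k * k ^ (card ?V - 1)"
    using ne fin by (metis card_gt_0_iff power_minus_mult mult.commute)
  ultimately show ?thesis using False by simp
qed simp

lemma bdd_above_sages_win: "pair_graph G \<Longrightarrow> bdd_above {k. sages_win G k}"
  by (rule bdd_aboveI) (auto dest: sages_win_le_card)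

lemma le_hat_guessing_number: "pair_graph G \<Longrightarrow> sages_win G k \<Longrightarrow> k \<le> hat_guessing_number G"
  unfolding hat_guessing_number_def by (rule cSup_upper) (auto intro: bdd_above_sages_win)

lemma sages_win_hat_guessing_number:
  assumes G: "pair_graph G" and ne: "pverts G \<noteq> {}"
  shows "sages_win G (hat_guessing_number G)"
proof -
  obtain w where w: "w \<in> pverts G" using ne by blast
  have "winning_strategy G 1 (\<lambda>_ _. 0)"
    unfolding winning_strategy_def strategy_def using w by (fastforce simp: PiE_iff)
  then have "{k. sages_win G k} \<noteq> {}" unfolding sages_win_def by blast
  moreover have "finite {k. sages_win G k}"
    using bdd_above_sages_win[OF G] by (simp add: bdd_above_nat)
  ultimately have "Sup {k. sages_win G k} \<in> {k. sages_win G k}"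
    using Max_in by (metis Sup_nat_def)
  then show ?thesis by (simp add: hat_guessing_number_def)
qed

end

theory Submission
  imports Defs
begin

text \<open>
  A vertex \<open>v\<close> sees everything, so it suffices to determine the four binary digits of its colour.
  For one digit, play on the outerplanar rest with two guesses per vertex, one for each value of
  the digit: \<open>v\<close> sees which of the two guesses succeeds and bets on the other digit. In the rest a
  hub \<open>u\<close> is joined to many paths on three vertices. For a partition of the colours of \<open>u\<close> into
  three classes, a path sees the class of \<open>u\<close> and thus has \<open>2 \<cdot> 3 = 6\<close> guesses per vertex, which is
  enough to win on it with 14 colours; so \<open>u\<close> can exclude one class of every partition. At most two
  colours survive all these exclusions, and \<open>u\<close> has two guesses.

  The graph is a vertex joined to a noncrossing graph. It is drawn with the noncrossing graph as
  chords of the concave arc \<open>y = -x\<^sup>2\<close> and the apex high above it.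
\<close>

text \<open>Lets guesses read the whole colouring: by \<open>dep\<close>, restricting it to the
  neighbours changes nothing.\<close>

lemma sages_winI:
  assumes dep: "\<And>v c d. v \<in> pverts G \<Longrightarrow> (\<And>u. u \<in> neighbors G v \<Longrightarrow> c u = d u) \<Longrightarrow> F v c = F v d"
    and bound: "\<And>v c. v \<in> pverts G \<Longrightarrow> F v c < k"
    and win: "\<And>c. (\<And>v. v \<in> pverts G \<Longrightarrow> c v < k) \<Longrightarrow> \<exists>v \<in> pverts G. F v c = c v"
  shows "sages_win G k"
proof -
  have "F v (restrict c (neighbors G v)) = F v c" if "v \<in> pverts G" for v c
    using that by (rule dep) simp
  moreover have "\<exists>v \<in> pverts G. F v c = c v" if "c \<in> colorings k (pverts G)" for c
    using that by (intro win) auto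
  ultimately have "winning_strategy G k F"
    unfolding winning_strategy_def strategy_def using bound by auto
  then show ?thesis unfolding sages_win_def by blast
qed

section \<open>Planarity of an apex over a noncrossing graph\<close>

text \<open>The tangent to the arc at abscissa \<open>n\<close> meets the vertical axis at height
  \<open>n^2\<close>, so height \<open>L^2\<close> puts the apex above the tangents at all vertices
  \<open>n < L\<close>.\<close>

definition apex_point :: "nat \<Rightarrow> nat \<Rightarrow> complex" where
  "apex_point L n = (if n = 0 then Complex 0 (real L ^ 2) else Complex (real n) (- (real n ^ 2)))"

text \<open>
  The quantity \<open>Im z + (Re z)\<^sup>2\<close> separates the two kinds of edges: it is nonpositive on chords of
  the parabola and nonnegative on edges at the apex, and vanishes only on the parabola.
\<close>

lemma chord_point:
  assumes "z \<in> closed_segment (apex_point L m) (apex_point L n)" and "0 < m" "m < n"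
  shows "real m \<le> Re z" "Re z \<le> real n"
    "Im z + (Re z)^2 = (Re z - real m) * (Re z - real n)"
proof -
  obtain t where t: "0 \<le> t" "t \<le> 1"
    and z: "z = (1 - t) *\<^sub>R apex_point L m + t *\<^sub>R apex_point L n"
    using assms(1) unfolding closed_segment_def by blast
  have re: "Re z = real m + t * (real n - real m)"
    and im: "Im z = - ((1 - t) * real m ^ 2 + t * real n ^ 2)"
    using assms unfolding z apex_point_def by (auto simp: algebra_simps)
  show "real m \<le> Re z" using t assms by (simp add: re)
  have "t * (real n - real m) \<le> 1 * (real n - real m)"
    using t assms by (intro mult_right_mono) auto
  then show "Re z \<le> real n" by (simp add: re)
  show "Im z + (Re z)^2 = (Re z - real m) * (Re z - real n)"
    unfolding re im by algebra
qed

lemma ray_point: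
  assumes "z \<in> closed_segment (apex_point L 0) (apex_point L n)" and "0 < n" "n < L"
  obtains t where "0 \<le> t" "t \<le> 1" "Re z = t * real n"
    "Im z + (Re z)^2 = (1 - t) * (real L ^ 2 - t * real n ^ 2)"
    "0 \<le> Im z + (Re z)^2"
    "Im z + (Re z)^2 = 0 \<longrightarrow> t = 1"
proof -
  obtain t where t: "0 \<le> t" "t \<le> 1"
    and z: "z = (1 - t) *\<^sub>R apex_point L 0 + t *\<^sub>R apex_point L n"
    using assms(1) unfolding closed_segment_def by blast
  have re: "Re z = t * real n"
    and im: "Im z = (1 - t) * real L ^ 2 - t * real n ^ 2"
    using assms unfolding z apex_point_def by (auto simp: algebra_simps)
  have eq: "Im z + (Re z)^2 = (1 - t) * (real L ^ 2 - t * real n ^ 2)"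
    unfolding re im by algebra
  have "t * real n ^ 2 \<le> 1 * real n ^ 2" using t by (intro mult_right_mono) auto
  moreover have "real n ^ 2 < real L ^ 2" using assms by (intro power_strict_mono) auto
  ultimately have pos: "0 < real L ^ 2 - t * real n ^ 2" by simp
  show thesis
  proof (rule that[OF t re eq])
    show "0 \<le> Im z + (Re z)^2" unfolding eq using pos t by simp
    show "Im z + (Re z)^2 = 0 \<longrightarrow> t = 1" unfolding eq using pos by simp
  qed
qed

lemma apex_point_eqI:
  assumes "0 < n" "Re z = real n" "Im z + (Re z)^2 = 0"
  shows "z = apex_point L n"
  using assms by (auto simp: apex_point_def complex_eq_iff)

lemma inj_apex_point: "inj (apex_point L)"
  by (rule injI) (auto simp: apex_point_def split: if_splits)

text \<open>With \<open>x = Re z\<close>, a common point forces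
  \<open>(x - m) * (n - x) = (x - r) * (s - x)\<close>. For nested intervals the outer product is
  strictly larger inside the inner one; intervals side by side share at most an endpoint.\<close>

lemma chord_chord:
  assumes z: "z \<in> closed_segment (apex_point L m) (apex_point L n)"
      "z \<in> closed_segment (apex_point L r) (apex_point L s)"
    and ord: "0 < m" "m < n" "0 < r" "r < s" "(m, n) \<noteq> (r, s)"
    and nc: "\<not> (m < r \<and> r < n \<and> n < s)" "\<not> (r < m \<and> m < s \<and> s < n)"
  shows "z \<in> apex_point L ` ({m, n} \<inter> {r, s})"
proof -
  have nested: "z \<in> apex_point L ` ({m, n} \<inter> {r, s})"
    if z: "z \<in> closed_segment (apex_point L m) (apex_point L n)"
      "z \<in> closed_segment (apex_point L r) (apex_point L s)"
    and ord: "0 < m" "m \<le> r" "r < s" "s \<le> n" "(m, n) \<noteq> (r, s)" for m n r s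
  proof -
    let ?x = "Re z"
    have 1: "real m \<le> ?x" "?x \<le> real n" "Im z + ?x^2 = (?x - real m) * (?x - real n)"
      using chord_point[OF z(1)] ord by auto
    have 2: "real r \<le> ?x" "?x \<le> real s" "Im z + ?x^2 = (?x - real r) * (?x - real s)"
      using chord_point[OF z(2)] ord by auto
    have eq: "(?x - real m) * (real n - ?x) = (?x - real r) * (real s - ?x)"
      using 1(3) 2(3) by (simp add: algebra_simps)
    consider "?x = real r" | "?x = real s" | "real r < ?x" "?x < real s" using 2 by linarith
    then show ?thesis
    proof cases
      case 1
      then have "m = r" using eq ord by auto
      moreover have "z = apex_point L r" using 1 2 ord by (intro apex_point_eqI) auto
      ultimately show ?thesis by auto
    next
      case 2
      then have "n = s" using eq ord by auto
      moreover have "z = apex_point L s" 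
        using 2 \<open>Im z + ?x^2 = (?x - real r) * (?x - real s)\<close> ord by (intro apex_point_eqI) auto
      ultimately show ?thesis by auto
    next
      case 3
      have "(?x - real r) * (real s - ?x) < (?x - real m) * (real n - ?x)"
      proof (cases "m = r")
        case True
        then have "real s - ?x < real n - ?x" using ord by auto
        then show ?thesis using mult_strict_left_mono[of _ _ "?x - real r"] 3 True by simp
      next
        case False
        then show ?thesis using 3 ord by (intro mult_less_le_imp_less) auto
      qed
      then show ?thesis using eq by simp
    qed
  qed
  have apart: "z \<in> apex_point L ` ({m, n} \<inter> {r, s})"
    if z: "z \<in> closed_segment (apex_point L m) (apex_point L n)"
      "z \<in> closed_segment (apex_point L r) (apex_point L s)"
    and ord: "0 < m" "m < n" "n \<le> r" "r < s" for m n r s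
  proof -
    have "Re z \<le> real n" "real r \<le> Re z" "Im z + (Re z)^2 = (Re z - real m) * (Re z - real n)"
      using chord_point[OF z(1)] chord_point[OF z(2)] ord by auto
    then have "n = r" "z = apex_point L n" using ord by (auto intro!: apex_point_eqI)
    then show ?thesis by auto
  qed
  consider "n \<le> r" | "s \<le> m" | "m \<le> r" "s \<le> n" | "r \<le> m" "n \<le> s" using nc by linarith
  then show ?thesis
  proof cases
    case 1
    then show ?thesis using apart[OF z] ord by simp
  next
    case 2
    then show ?thesis using apart[OF z(2,1)] ord by (simp add: Int_commute)
  next
    case 3
    then show ?thesis using nested[OF z] ord by simp
  next
    case 4
    then have "z \<in> apex_point L ` ({r, s} \<inter> {m, n})" using nested[OF z(2,1)] ord by auto
    then show ?thesis by (simp only: Int_commute)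
  qed
qed

text \<open>\<open>Im z + (Re z)^2\<close> is nonnegative on the ray and nonpositive on the chord,
  hence zero at a common point, which is then an end of both.\<close>

lemma ray_chord:
  assumes "z \<in> closed_segment (apex_point L 0) (apex_point L n)"
    "z \<in> closed_segment (apex_point L r) (apex_point L s)"
    and "0 < n" "n < L" "0 < r" "r < s"
  shows "z \<in> apex_point L ` ({0, n} \<inter> {r, s})"
proof -
  obtain t where t: "Re z = t * real n" "0 \<le> Im z + (Re z)^2" "Im z + (Re z)^2 = 0 \<longrightarrow> t = 1"
    using ray_point assms by metis
  have c: "real r \<le> Re z" "Re z \<le> real s" "Im z + (Re z)^2 = (Re z - real r) * (Re z - real s)"
    using chord_point[OF assms(2)] assms by auto
  have "(Re z - real r) * (Re z - real s) \<le> 0" using c by (intro mult_nonneg_nonpos) auto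
  then have 0: "Im z + (Re z)^2 = 0" "(Re z - real r) * (Re z - real s) = 0" using t c by auto
  then have "Re z = real n" using t by simp
  moreover from this have "n = r \<or> n = s" using 0 by auto
  ultimately show ?thesis using apex_point_eqI[of n z L] 0 assms by auto
qed

text \<open>Rays to distinct \<open>m\<close> and \<open>n\<close> have equal slope only if
  \<open>m * n = L^2\<close>, but both are below \<open>L\<close>.\<close>

lemma ray_ray:
  assumes "z \<in> closed_segment (apex_point L 0) (apex_point L m)"
    "z \<in> closed_segment (apex_point L 0) (apex_point L n)"
    and "0 < m" "m < L" "0 < n" "n < L" "m \<noteq> n"
  shows "z = apex_point L 0"
proof -
  obtain t where t: "Re z = t * real m"
    "Im z + (Re z)^2 = (1 - t) * (real L ^ 2 - t * real m ^ 2)"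
    using ray_point[OF assms(1)] assms by metis
  obtain t' where t': "Re z = t' * real n"
    "Im z + (Re z)^2 = (1 - t') * (real L ^ 2 - t' * real n ^ 2)"
    using ray_point[OF assms(2)] assms by metis
  have eq: "t * (real L ^ 2 + real m ^ 2) = t' * (real L ^ 2 + real n ^ 2)"
  proof -
    have "(1 - t) * (real L ^ 2 - t * real m ^ 2) = real L ^ 2 - t * (real L ^ 2 + real m ^ 2) + (t * real m)^2"
      "(1 - t') * (real L ^ 2 - t' * real n ^ 2) = real L ^ 2 - t' * (real L ^ 2 + real n ^ 2) + (t' * real n)^2"
      by algebra+
    then show ?thesis using t t' by simp
  qed
  have "t * real m = t' * real n" using t t' by simp
  then have "t * ((real m - real n) * (real L ^ 2 - real m * real n)) = 0"
    using eq by algebra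
  moreover have "real m * real n < real L * real L"
    using assms by (intro mult_strict_mono) auto
  ultimately have "t = 0" using assms by (auto simp: power2_eq_square)
  then have "Re z = 0" "Im z = real L ^ 2" using t by auto
  then show ?thesis by (simp add: apex_point_def complex_eq_iff)
qed

lemma planar_apex_noncrossing:
  fixes G :: "nat pair_pre_digraph"
  assumes G: "pair_graph G"
    and nc: "\<And>m n r s. (m, n) \<in> parcs G \<Longrightarrow> (r, s) \<in> parcs G \<Longrightarrow> 0 < m \<Longrightarrow> m < r \<Longrightarrow> r < n \<Longrightarrow> n < s \<Longrightarrow> False"
  shows "planar G"
proof -
  interpret pair_graph G by fact
  obtain L where L: "\<And>n. n \<in> pverts G \<Longrightarrow> n < L"
    using finite_nat_set_iff_bounded pair_finite_verts by metis
  let ?p = "apex_point L"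
  \<comment> \<open>\<open>Min\<close> and \<open>Max\<close> orient the curve, which is indexed by
    an unordered edge.\<close>
  define \<gamma> where "\<gamma> e = linepath (?p (Min e)) (?p (Max e))" for e
  have \<gamma>: "\<gamma> {m, n} = linepath (?p m) (?p n)" "\<gamma> {n, m} = linepath (?p m) (?p n)" if "m < n" for m n
    using that by (auto simp: \<gamma>_def)
  have img: "path_image (\<gamma> {m, n}) = closed_segment (?p m) (?p n)" for m n
  proof (cases m n rule: linorder_cases)
    case greater
    then show ?thesis using \<gamma>(2)[of n m] by (simp add: closed_segment_commute)
  next
    case equal
    then show ?thesis unfolding \<gamma>_def by simp
  next
    case less
    then show ?thesis using \<gamma>(1) by simp
  qed
  have arcD: "m \<in> pverts G" "n \<in> pverts G" "m < L" "n < L" "m \<noteq> n" "(n, m) \<in> parcs G"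
    if "(m, n) \<in> parcs G" for m n
  proof -
    show v: "m \<in> pverts G" "n \<in> pverts G" using in_arcsD1[OF that] in_arcsD2[OF that] by auto
    then show "m < L" "n < L" using L by auto
    show "m \<noteq> n" using pair_no_loops[OF that] by auto
    show "(n, m) \<in> parcs G" using that by (rule arcs_symmetric)
  qed
  have up: "closed_segment (?p m) (?p n) \<inter> closed_segment (?p r) (?p s) \<subseteq> ?p ` ({m, n} \<inter> {r, s})"
    if e: "(m, n) \<in> parcs G" "(r, s) \<in> parcs G" "(m, n) \<noteq> (r, s)" "m < n" "r < s" for m n r s
  proof
    fix z assume z: "z \<in> closed_segment (?p m) (?p n) \<inter> closed_segment (?p r) (?p s)"
    note b = arcD[OF e(1)] arcD[OF e(2)]
    consider "m = 0" "r = 0" | "m = 0" "0 < r" | "0 < m" "r = 0" | "0 < m" "0 < r" by blast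
    then show "z \<in> ?p ` ({m, n} \<inter> {r, s})"
    proof cases
      case 1
      then have "z = ?p 0" using z e b ray_ray[of z L n s] by simp
      then show ?thesis using 1 by blast
    next
      case 2
      then show ?thesis using z e b ray_chord[of z L n r s] by simp
    next
      case 3
      then show ?thesis using z e b ray_chord[of z L s m n] by (simp add: Int_commute)
    next
      case 4
      then show ?thesis using z e nc[of m n r s] nc[of r s m n] chord_chord[of z L m n r s] by blast
    qed
  qed
  have cross: "path_image (\<gamma> {m, n}) \<inter> path_image (\<gamma> {r, s}) \<subseteq> ?p ` ({m, n} \<inter> {r, s})"
    if e: "(m, n) \<in> parcs G" "(r, s) \<in> parcs G" "{m, n} \<noteq> {r, s}" for m n r s
  proof -
    have lo: "\<exists>m' n'. (m', n') \<in> parcs G \<and> m' < n' \<and> {m', n'} = {m, n}"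
      if "(m, n) \<in> parcs G" for m n
      using that arcD(5,6)[OF that] by (metis insert_commute nat_neq_iff)
    obtain m' n' where 1: "(m', n') \<in> parcs G" "m' < n'" "{m', n'} = {m, n}"
      using lo[OF e(1)] by blast
    obtain r' s' where 2: "(r', s') \<in> parcs G" "r' < s'" "{r', s'} = {r, s}"
      using lo[OF e(2)] by blast
    have "(m', n') \<noteq> (r', s')" using 1 2 e(3) by auto
    then show ?thesis using up[OF 1(1) 2(1) _ 1(2) 2(2)] unfolding 1(3)[symmetric] 2(3)[symmetric] img by simp
  qed
  \<comment> \<open>A vertex on the arc has \<open>Im + Re^2 = 0\<close>, which on an edge happens
    only at an endpoint; the apex has abscissa 0 and so lies on no chord.\<close>
  have vert: "w \<in> {m, n}" if e: "(m, n) \<in> parcs G" "m < n" and w: "w \<in> pverts G" "?p w \<in> closed_segment (?p m) (?p n)" for m n w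
  proof (cases "m = 0")
    case True
    obtain t where t: "Re (?p w) = t * real n"
      "Im (?p w) + (Re (?p w))^2 = (1 - t) * (real L ^ 2 - t * real n ^ 2)"
      "Im (?p w) + (Re (?p w))^2 = 0 \<longrightarrow> t = 1"
      using w(2) e(2) arcD(4)[OF e(1)] unfolding True by (metis ray_point)
    show ?thesis
      using t True by (cases "w = 0") (auto simp: apex_point_def)
  next
    case False
    then have c: "real m \<le> Re (?p w)" "Im (?p w) + (Re (?p w))^2 = (Re (?p w) - real m) * (Re (?p w) - real n)"
      using chord_point[OF w(2)] e by auto
    show ?thesis
      using c False by (cases "w = 0") (auto simp: apex_point_def)
  qed
  have "plane_drawing G ?p \<gamma>"
    unfolding plane_drawing_def
  proof (intro conjI ballI)
    show "inj_on ?p (pverts G)" using inj_apex_point by (rule inj_on_subset) simp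
    fix e assume e: "e \<in> parcs G"
    obtain m n where mn: "e = (m, n)" by fastforce
    note b = arcD[OF e[unfolded mn]]
    have ne: "?p m \<noteq> ?p n" using b inj_apex_point by (auto dest: injD)
    have "?p ` pverts G \<inter> closed_segment (?p m) (?p n) \<subseteq> {?p m, ?p n}"
    proof (cases "m < n")
      case True
      then show ?thesis using vert[of m n] e mn by auto
    next
      case False
      then show ?thesis using vert[of n m] b by (auto simp: closed_segment_commute[of "?p n"])
    qed
    moreover have "Path_Connected.arc (\<gamma> {m, n}) \<and> {pathstart (\<gamma> {m, n}), pathfinish (\<gamma> {m, n})} = {?p m, ?p n}"
    proof (cases "m < n")
      case True
      then show ?thesis using ne by (simp add: \<gamma> arc_linepath)
    next
      case False
      then have "\<gamma> {m, n} = linepath (?p n) (?p m)" using \<gamma>(2)[of n m] b by simp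
      then show ?thesis using ne by (simp add: arc_linepath insert_commute)
    qed
    ultimately show "case e of (u, v) \<Rightarrow>
        Path_Connected.arc (\<gamma> {u, v}) \<and>
        {pathstart (\<gamma> {u, v}), pathfinish (\<gamma> {u, v})} = {?p u, ?p v} \<and>
        path_image (\<gamma> {u, v}) \<inter> ?p ` pverts G = {?p u, ?p v}"
      using b by (auto simp: mn img)
  next
    fix e assume e: "e \<in> parcs G"
    show "case e of (u, v) \<Rightarrow> \<forall>(x, y) \<in> parcs G. {u, v} \<noteq> {x, y} \<longrightarrow>
        path_image (\<gamma> {u, v}) \<inter> path_image (\<gamma> {x, y}) \<subseteq> ?p ` ({u, v} \<inter> {x, y})"
      using e cross by (clarsimp simp only: split_paired_all prod.case) blast
  qed
  then show ?thesis unfolding planar_def by blast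
qed

section \<open>The path on three vertices\<close>

text \<open>
  A guess index \<open>s < 6\<close> encodes one of three residues modulo 7 (\<open>s mod 3\<close>) and one of the two
  colours in that residue class (\<open>s div 3\<close>).
\<close>

definition end_guess :: "nat list \<Rightarrow> nat \<Rightarrow> nat \<Rightarrow> nat" where
  "end_guess ts s y = (y + ts ! (s mod 3)) mod 7 + 7 * (s div 3)"

text \<open>Residues of the middle colour at which no guess of either end has the right residue;
  only these are left to the middle sage.\<close>

definition mid_list :: "nat \<Rightarrow> nat \<Rightarrow> nat list" where
  "mid_list x z = filter (\<lambda>y. (\<forall>t \<in> set [0, 1, 3]. (y + t) mod 7 \<noteq> x) \<and>
     (\<forall>t \<in> set [0, 2, 3]. (y + t) mod 7 \<noteq> z)) [0..<7]"

definition mid_guess :: "nat \<Rightarrow> nat \<Rightarrow> nat \<Rightarrow> nat" where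
  "mid_guess s x z = (let ys = mid_list (x mod 7) (z mod 7) in
     if s mod 3 < length ys then ys ! (s mod 3) + 7 * (s div 3) else 0)"

definition path_win :: "nat \<Rightarrow> nat \<Rightarrow> nat \<Rightarrow> nat \<Rightarrow> bool" where
  "path_win s x y z \<longleftrightarrow>
     x = end_guess [0, 1, 3] s y \<or> y = mid_guess s x z \<or> z = end_guess [0, 2, 3] s y"

text \<open>
  Modulo 7, the colour of each end rules out three middle colours, and a translate of \<open>{0, -1, -3}\<close>
  is never a translate of \<open>{0, -2, -3}\<close>, so together the ends rule out at least four.
\<close>

lemma length_mid_list:
  assumes "x < 7" "z < 7"
  shows "length (mid_list x z) \<le> 3"
proof -
  have "\<forall>x \<in> set [0..<7]. \<forall>z \<in> set [0..<7]. length (mid_list x z) \<le> 3"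
    by code_simp
  then show ?thesis using assms by simp
qed

lemma end_guess_hit:
  assumes "x < 14" "length ts = 3" "t \<in> set ts" "(y mod 7 + t) mod 7 = x mod 7"
  shows "\<exists>s < 6. x = end_guess ts s y"
proof -
  obtain r where r: "r < 3" "t = ts ! r" using assms by (metis in_set_conv_nth)
  have "(y + t) mod 7 = x mod 7" using assms(4) by (simp add: mod_simps)
  \<comment> \<open>Position \<open>r\<close> fixes the residue, \<open>x div 7\<close> the colour
    within its class.\<close>
  then have "x = end_guess ts (r + 3 * (x div 7)) y"
    using r by (simp add: end_guess_def)
  moreover have "x div 7 \<le> 1" using assms(1) by simp
  then have "r + 3 * (x div 7) < 6" using r \<open>x div 7 \<le> 1\<close> by linarith
  ultimately show ?thesis by blast
qed

text \<open>If the residue of \<open>y\<close> is in the list, one of the six middle guesses is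
  \<open>y\<close>; otherwise an end that ruled it out has a guess equal to its own colour.\<close>

lemma path_win_ex:
  assumes "x < 14" "y < 14" "z < 14"
  shows "\<exists>s < 6. path_win s x y z"
proof -
  let ?ys = "mid_list (x mod 7) (z mod 7)"
  consider "y mod 7 \<in> set ?ys"
    | t where "t \<in> set [0, 1, 3]" "(y mod 7 + t) mod 7 = x mod 7"
    | t where "t \<in> set [0, 2, 3]" "(y mod 7 + t) mod 7 = z mod 7"
    unfolding mid_list_def by (auto simp del: list.set)
  then show ?thesis
  proof cases
    case 1
    then obtain r where r: "r < length ?ys" "y mod 7 = ?ys ! r" by (metis in_set_conv_nth)
    moreover have "length ?ys \<le> 3" by (intro length_mid_list) auto
    ultimately have "y = mid_guess (r + 3 * (y div 7)) x z" by (simp add: mid_guess_def Let_def flip: r(2))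
    moreover have "y div 7 \<le> 1" using assms by simp
    then have "r + 3 * (y div 7) < 6" using r \<open>length ?ys \<le> 3\<close> by linarith
    ultimately show ?thesis unfolding path_win_def by blast
  next
    case 2
    then show ?thesis using end_guess_hit[of x "[0, 1, 3]" t y] assms unfolding path_win_def by auto
  next
    case 3
    then show ?thesis using end_guess_hit[of z "[0, 2, 3]" t y] assms unfolding path_win_def by auto
  qed
qed

lemma end_guess_less: "s < 6 \<Longrightarrow> end_guess ts s y < 14"
proof -
  assume "s < 6"
  then have "s div 3 \<le> 1" by simp
  moreover have "(y + ts ! (s mod 3)) mod 7 < 7" by simp
  ultimately show ?thesis unfolding end_guess_def by linarith
qed

lemma mid_guess_less:
  assumes "s < 6"
  shows "mid_guess s x z < 14"
proof -
  have "s div 3 \<le> 1" using assms by simp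
  moreover have "mid_list a b ! r < 7" if "r < length (mid_list a b)" for a b r
    using nth_mem[OF that] by (simp add: mid_list_def)
  ultimately show ?thesis unfolding mid_guess_def Let_def by fastforce
qed

section \<open>The graph and its strategy\<close>

text \<open>
  Vertex 0 is the apex; block \<open>i\<close> consists of its hub and \<open>196 = 14\<^sup>2\<close> paths of three consecutive
  vertices, hence \<open>589 = 1 + 3 \<cdot> 196\<close> vertices. Consecutive paths and blocks are joined by edges
  which the strategy ignores.
\<close>

definition hub :: "nat \<Rightarrow> nat" where
  "hub i = 1 + 589 * i"

definition path_start :: "nat \<Rightarrow> nat \<Rightarrow> nat" where
  "path_start i j = hub i + 1 + 3 * j"

text \<open>\<open>m mod 589 = 1\<close> makes \<open>m\<close> a hub, and
  \<open>n < m + 589\<close> keeps \<open>n\<close> in its block.\<close>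

definition adj :: "nat \<Rightarrow> nat \<Rightarrow> bool" where
  "adj m n \<longleftrightarrow> m < n \<and> (m = 0 \<or> n = Suc m \<or> (m mod 589 = 1 \<and> n < m + 589))"

definition hat_graph :: "nat pair_pre_digraph" where
  "hat_graph = \<lparr>pverts = {..<hub 4}, parcs = {(m, n). m < hub 4 \<and> n < hub 4 \<and> (adj m n \<or> adj n m)}\<rparr>"

lemma pair_graph_hat_graph: "pair_graph hat_graph"
proof
  have "parcs hat_graph \<subseteq> pverts hat_graph \<times> pverts hat_graph" by (auto simp: hat_graph_def)
  then show "finite (parcs hat_graph)" by (rule finite_subset) (simp add: hat_graph_def)
qed (auto simp: hat_graph_def adj_def symmetric_def sym_def)

text \<open>Interleaving edges away from the apex both skip a vertex, so both start at hubs; but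
  \<open>r < n < m + 589\<close> leaves no room for a hub after \<open>m\<close>.\<close>

lemma planar_hat_graph: "planar hat_graph"
proof (rule planar_apex_noncrossing[OF pair_graph_hat_graph])
  fix m n r s
  assume e: "(m, n) \<in> parcs hat_graph" "(r, s) \<in> parcs hat_graph"
    and o: "0 < m" "m < r" "r < n" "n < s"
  have "m mod 589 = 1" "n < m + 589" "r mod 589 = 1"
    using e o by (auto simp: hat_graph_def adj_def)
  moreover from this have "589 dvd r - m" using o by (simp flip: mod_eq_dvd_iff_nat)
  then have "589 \<le> r - m" using o by (intro dvd_imp_le) auto
  ultimately show False using o by linarith
qed

section \<open>Guesses of the paths, the hubs and the apex\<close>

definition bit_of :: "nat \<Rightarrow> nat \<Rightarrow> nat" where
  "bit_of x i = x div 2 ^ i mod 2"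

text \<open>Path \<open>j\<close> separates the colours \<open>j div 14\<close> and \<open>j mod 14\<close> from each other and from the rest.\<close>

definition part :: "nat \<Rightarrow> nat \<Rightarrow> nat" where
  "part j d = (if d = j div 14 then 0 else if d = j mod 14 then 1 else 2)"

text \<open>The hub colour is an argument \<open>d\<close>, since the hub must test colours without
  seeing its own. The index packs digit and class into one of six values.\<close>

definition block_path_win :: "(nat \<Rightarrow> nat) \<Rightarrow> nat \<Rightarrow> nat \<Rightarrow> nat \<Rightarrow> nat \<Rightarrow> bool" where
  "block_path_win c i b d j \<longleftrightarrow>
     path_win (b + 2 * part j d) (c (path_start i j)) (c (path_start i j + 1)) (c (path_start i j + 2))"

text \<open>A hub colour outside this list lets some path win for at least one digit value, so the
  hub need cover only the list, one entry per digit value.\<close>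

definition hub_list :: "(nat \<Rightarrow> nat) \<Rightarrow> nat \<Rightarrow> nat list" where
  "hub_list c i = filter (\<lambda>d. \<forall>j<196. \<forall>b<2. \<not> block_path_win c i b d j) [0..<14]"

definition hub_guess :: "(nat \<Rightarrow> nat) \<Rightarrow> nat \<Rightarrow> nat \<Rightarrow> nat" where
  "hub_guess c i b = (if b < length (hub_list c i) then hub_list c i ! b else 0)"

definition block_win :: "(nat \<Rightarrow> nat) \<Rightarrow> nat \<Rightarrow> nat \<Rightarrow> bool" where
  "block_win c i b \<longleftrightarrow> c (hub i) = hub_guess c i b \<or> (\<exists>j<196. block_path_win c i b (c (hub i)) j)"

text \<open>Seeks a colour whose digits all lose; the default 0 keeps the guess in range.\<close>

definition apex_guess :: "(nat \<Rightarrow> nat) \<Rightarrow> nat" where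
  "apex_guess c = (let P = \<lambda>x. x < 14 \<and> (\<forall>i<4. \<not> block_win c i (bit_of x i)) in
     if Ex P then Eps P else 0)"

definition hat_guess :: "nat \<Rightarrow> (nat \<Rightarrow> nat) \<Rightarrow> nat" where
  "hat_guess n c =
     (if n = 0 then apex_guess c
      else let i = (n - 1) div 589; q = (n - 1) mod 589; b = bit_of (c 0) i in
        if q = 0 then hub_guess c i b
        else let s = b + 2 * part ((q - 1) div 3) (c (hub i)) in
          if (q - 1) mod 3 = 0 then end_guess [0, 1, 3] s (c (n + 1))
          else if (q - 1) mod 3 = 1 then mid_guess s (c (n - 1)) (c (n + 1))
          else end_guess [0, 2, 3] s (c (n - 1)))"

text \<open>
  Three distinct colours in the list would be separated by some partition \<^term>\<open>part j\<close>, whose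
  path excludes one of the three classes.
\<close>

lemma length_hub_list:
  assumes c: "\<And>n. n < hub 4 \<Longrightarrow> c n < 14" and i: "i < 4"
  shows "length (hub_list c i) \<le> 2"
proof (rule ccontr)
  assume len: "\<not> length (hub_list c i) \<le> 2"
  let ?D = "hub_list c i"
  have dist: "distinct ?D" by (simp add: hub_list_def)
  have l: "0 < length ?D" "1 < length ?D" "2 < length ?D" using len by linarith+
  \<comment> \<open>The partition isolating the first two entries, with the third in class
    2.\<close>
  define j where "j = ?D ! 0 * 14 + ?D ! 1"
  have D: "?D ! r < 14" if "r < 3" for r
    using nth_mem[of r ?D] that len by (auto simp: hub_list_def)
  have j: "j < 196" using D[of 0] D[of 1] by (simp add: j_def)
  have part: "part j (?D ! r) = r" if "r < 3" for r
  proof -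
    have "j div 14 = ?D ! 0" "j mod 14 = ?D ! 1" using D[of 1] by (simp_all add: j_def)
    moreover have "?D ! 0 \<noteq> ?D ! 1" "?D ! 0 \<noteq> ?D ! 2" "?D ! 1 \<noteq> ?D ! 2"
      using l by (simp_all add: nth_eq_iff_index_eq[OF dist])
    moreover have "r = 0 \<or> r = 1 \<or> r = 2" using that by auto
    ultimately show ?thesis by (auto simp: part_def)
  qed
  have "path_start i j + 2 < hub 4" using i j by (simp add: path_start_def hub_def)
  then obtain s where s: "s < 6"
    "path_win s (c (path_start i j)) (c (path_start i j + 1)) (c (path_start i j + 2))"
    using path_win_ex c by (metis add_lessD1 one_add_one add.assoc)
  \<comment> \<open>The index decodes to digit \<open>s mod 2\<close> and class
    \<open>s div 2\<close>; the list entry of this class should have been excluded by path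
    \<open>j\<close>.\<close>
  have "s div 2 < 3" using s by simp
  then have "block_path_win c i (s mod 2) (?D ! (s div 2)) j"
    using s part by (simp add: block_path_win_def)
  moreover have "?D ! (s div 2) \<in> set ?D" using \<open>s div 2 < 3\<close> len by (intro nth_mem) simp
  ultimately show False using j by (auto simp: hub_list_def)
qed

text \<open>A hub colour in the list is guessed for the digit equal to its position; for any other,
  a path wins for some digit.\<close>

lemma block_win_ex:
  assumes c: "\<And>n. n < hub 4 \<Longrightarrow> c n < 14" and i: "i < 4"
  shows "\<exists>b<2. block_win c i b"
proof (cases "c (hub i) \<in> set (hub_list c i)")
  case True
  then obtain b where "b < length (hub_list c i)" "c (hub i) = hub_list c i ! b"
    by (metis in_set_conv_nth)
  moreover have "length (hub_list c i) \<le> 2" using length_hub_list[OF c i] .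
  ultimately show ?thesis unfolding block_win_def hub_guess_def by (intro exI[of _ b]) auto
next
  case False
  moreover have "c (hub i) < 14" using i by (intro c) (simp add: hub_def)
  ultimately show ?thesis unfolding hub_list_def block_win_def by auto
qed

lemma bit_of_eqI:
  assumes "x < 14" "y < 14" "\<And>i. i < 4 \<Longrightarrow> bit_of x i = bit_of y i"
  shows "x = y"
proof -
  let ?sum = "\<lambda>x. bit_of x 0 + 2 * bit_of x 1 + 4 * bit_of x 2 + 8 * bit_of x 3"
  have all: "\<forall>x \<in> set [0..<14]. x = ?sum x" by code_simp
  have "x = ?sum x" using assms(1) by (intro bspec[OF all]) simp
  also have "\<dots> = ?sum y" using assms(3) by simp
  also have "\<dots> = y" using assms(2) by (intro bspec[OF all, symmetric]) simp
  finally show ?thesis .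
qed

text \<open>In each block some digit value wins, so at most one loses: a colour whose digits all
  lose agrees with \<open>c 0\<close> in every digit.\<close>

lemma apex_guess_eq:
  assumes c: "\<And>n. n < hub 4 \<Longrightarrow> c n < 14"
    and lose: "\<And>i. i < 4 \<Longrightarrow> \<not> block_win c i (bit_of (c 0) i)"
  shows "apex_guess c = c 0"
proof -
  let ?P = "\<lambda>x. x < 14 \<and> (\<forall>i<4. \<not> block_win c i (bit_of x i))"
  have 0: "?P (c 0)" using lose c by (simp add: hub_def)
  have "x = c 0" if x: "?P x" for x
  proof (rule bit_of_eqI)
    fix i :: nat assume i: "i < 4"
    then obtain b where "b < 2" "block_win c i b" using block_win_ex[of c, OF c i] by blast
    moreover have "\<not> block_win c i (bit_of x i)" "\<not> block_win c i (bit_of (c 0) i)"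
      using x lose i by auto
    moreover have "bit_of x i < 2" "bit_of (c 0) i < 2" by (simp_all add: bit_of_def)
    ultimately show "bit_of x i = bit_of (c 0) i" by (metis less_2_cases)
  qed (use x 0 in auto)
  then have "Eps ?P = c 0" using 0 by (intro some_equality)
  then show ?thesis unfolding apex_guess_def Let_def using 0 by auto
qed

lemma hat_guess_wins:
  assumes c: "\<And>n. n < hub 4 \<Longrightarrow> c n < 14"
  shows "\<exists>n < hub 4. hat_guess n c = c n"
proof (cases "\<exists>i<4. block_win c i (bit_of (c 0) i)")
  case False
  then have "hat_guess 0 c = c 0" using apex_guess_eq c by (simp add: hat_guess_def)
  then show ?thesis by (intro exI[of _ 0]) (simp add: hub_def)
next
  case True
  then obtain i where i: "i < 4" and win: "block_win c i (bit_of (c 0) i)" by blast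
  let ?b = "bit_of (c 0) i"
  have h: "hat_guess (hub i) c = hub_guess c i ?b" by (simp add: hat_guess_def hub_def)
  from win consider "c (hub i) = hub_guess c i ?b"
    | j where "j < 196" "block_path_win c i ?b (c (hub i)) j" unfolding block_win_def by blast
  then show ?thesis
  proof cases
    case 1
    then show ?thesis using h i by (intro exI[of _ "hub i"]) (simp add: hub_def)
  next
    case 2
    let ?n = "path_start i j" and ?s = "?b + 2 * part j (c (hub i))"
    have pos: "?n + r - 1 = 589 * i + (1 + 3 * j + r)" for r
      by (simp add: path_start_def hub_def)
    have q: "(?n + r - 1) div 589 = i" "(?n + r - 1) mod 589 = 1 + 3 * j + r" "?n + r \<noteq> 0" "?n + r < hub 4" if "r < 3" for r
    proof -
      have lt: "1 + 3 * j + r < 589" using that 2 by simp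
      show "(?n + r - 1) div 589 = i" "(?n + r - 1) mod 589 = 1 + 3 * j + r"
        unfolding pos using lt by (simp_all add: div_mult_self4 del: add.assoc)
      show "?n + r \<noteq> 0" by (simp add: path_start_def)
      show "?n + r < hub 4" using lt i by (simp add: path_start_def hub_def)
    qed
    have [simp]: "Suc (3 * j) div 3 = j" "Suc (Suc (3 * j)) div 3 = j"
      "Suc (3 * j) mod 3 = 1" "Suc (Suc (3 * j)) mod 3 = 2" by presburger+
    have "hat_guess ?n c = end_guess [0, 1, 3] ?s (c (?n + 1))"
      using q[of 0] by (simp add: hat_guess_def Let_def)
    moreover have "hat_guess (?n + 1) c = mid_guess ?s (c ?n) (c (?n + 2))"
      using q[of 1] by (simp add: hat_guess_def Let_def)
    moreover have "hat_guess (?n + 2) c = end_guess [0, 2, 3] ?s (c (?n + 1))"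
      using q[of 2] by (simp add: hat_guess_def Let_def)
    ultimately have "hat_guess ?n c = c ?n \<or> hat_guess (?n + 1) c = c (?n + 1)
      \<or> hat_guess (?n + 2) c = c (?n + 2)"
      using 2(2) unfolding block_path_win_def path_win_def by argo
    moreover have "?n < hub 4" "?n + 1 < hub 4" "?n + 2 < hub 4"
      using q(4)[of 0] q(4)[of 1] q(4)[of 2] by simp_all
    ultimately show ?thesis by blast
  qed
qed

lemma hat_guess_less: "hat_guess n c < 14"
proof -
  have "apex_guess c < 14"
    using someI_ex[of "\<lambda>x. x < 14 \<and> (\<forall>i<4. \<not> block_win c i (bit_of x i))"]
    by (auto simp: apex_guess_def Let_def)
  moreover have "hub_guess c i b < 14" for i b
  proof (cases "b < length (hub_list c i)")
    case True
    then have "hub_list c i ! b \<in> set (hub_list c i)" by (rule nth_mem)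
    then show ?thesis using True by (auto simp: hub_guess_def hub_list_def)
  qed (simp add: hub_guess_def)
  moreover have "bit_of x i + 2 * part j d < 6" for x i j d
  proof -
    have "bit_of x i < 2" "part j d \<le> 2" by (auto simp: bit_of_def part_def)
    then show ?thesis by linarith
  qed
  ultimately show ?thesis
    by (simp add: hat_guess_def Let_def end_guess_less mid_guess_less)
qed

section \<open>Dependence of the guesses on visible colours only\<close>

lemma block_path_win_cong:
  assumes "c (path_start i j) = d (path_start i j)" "c (path_start i j + 1) = d (path_start i j + 1)"
    "c (path_start i j + 2) = d (path_start i j + 2)"
  shows "block_path_win c i b x j = block_path_win d i b x j"
  using assms by (simp add: block_path_win_def)

text \<open>The bounds leave out the hub, whose own colour must not enter its guess.\<close>

lemma hub_guess_cong:
  assumes "\<And>n. hub i < n \<Longrightarrow> n < hub (Suc i) \<Longrightarrow> c n = d n"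
  shows "hub_guess c i b = hub_guess d i b"
    "\<And>j x. j < 196 \<Longrightarrow> block_path_win c i b x j = block_path_win d i b x j"
proof -
  show lw: "block_path_win c i b x j = block_path_win d i b x j" if "j < 196" for b x j
    using that by (intro block_path_win_cong assms) (auto simp: path_start_def hub_def)
  then have "hub_list c i = hub_list d i"
    unfolding hub_list_def by (intro filter_cong) auto
  then show "hub_guess c i b = hub_guess d i b" by (simp add: hub_guess_def)
qed

lemma hat_guess_cong:
  assumes n: "n \<in> pverts hat_graph"
    and eq: "\<And>u. u \<in> neighbors hat_graph n \<Longrightarrow> c u = d u"
  shows "hat_guess n c = hat_guess n d"
proof -
  have lt: "n < hub 4" using n by (simp add: hat_graph_def)
  have eq: "c u = d u" if "adj n u \<or> adj u n" "u < hub 4" for u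
    using eq[of u] that lt by (auto simp: neighbors_def hat_graph_def)
  show ?thesis
  proof (cases "n = 0")
    case True
    have cd: "c u = d u" if "0 < u" "u < hub 4" for u
      using eq[of u] that True by (simp add: adj_def)
    have "block_win c i b = block_win d i b" if "i < 4" for i b
    proof -
      have "c u = d u" if "hub i < u" "u < hub (Suc i)" for u
        using that \<open>i < 4\<close> by (intro cd) (auto simp: hub_def)
      note cong = hub_guess_cong[of i c d, OF this]
      have "c (hub i) = d (hub i)" using that by (intro cd) (auto simp: hub_def)
      then show ?thesis unfolding block_win_def using cong by auto
    qed
    then have "(\<lambda>x. x < 14 \<and> (\<forall>i<4. \<not> block_win c i (bit_of x i)))
      = (\<lambda>x. x < 14 \<and> (\<forall>i<4. \<not> block_win d i (bit_of x i)))" by auto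
    then show ?thesis using True by (simp add: hat_guess_def apex_guess_def)
  next
    case False
    define i q where "i = (n - 1) div 589" and "q = (n - 1) mod 589"
    have nq: "n = hub i + q" "q < 589" using False by (auto simp: hub_def i_def q_def)
    have i: "i < 4" using lt nq by (simp add: hub_def)
    have 0: "c 0 = d 0" using False by (intro eq) (auto simp: adj_def hub_def)
    have g: "hat_guess n e = (if q = 0 then hub_guess e i (bit_of (e 0) i)
      else let s = bit_of (e 0) i + 2 * part ((q - 1) div 3) (e (hub i)) in
        if (q - 1) mod 3 = 0 then end_guess [0, 1, 3] s (e (n + 1))
        else if (q - 1) mod 3 = 1 then mid_guess s (e (n - 1)) (e (n + 1))
        else end_guess [0, 2, 3] s (e (n - 1)))" for e
      using False by (simp only: hat_guess_def Let_def i_def q_def if_False)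
    show ?thesis
    proof (cases "q = 0")
      case True
      have "c u = d u" if "hub i < u" "u < hub (Suc i)" for u
        using that i nq True by (intro eq) (auto simp: adj_def hub_def)
      then have "hub_guess c i b = hub_guess d i b" for b by (rule hub_guess_cong)
      then show ?thesis using True 0 by (simp add: g)
    next
      case q: False
      have "adj (hub i) n" using nq q unfolding adj_def by (auto simp: hub_def)
      then have h: "c (hub i) = d (hub i)" using i by (intro eq) (auto simp: hub_def)
      have m: "c (n - 1) = d (n - 1)" using False lt by (intro eq) (auto simp: adj_def)
      have p: "c (n + 1) = d (n + 1)" if "(q - 1) mod 3 \<noteq> 2"
      proof -
        \<comment> \<open>\<open>q = 588\<close> is the third vertex of the last path in the block,
          where \<open>n + 1\<close> may leave the graph; third vertices look only back along the
          path.\<close>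
        have "q \<noteq> 588" using that by auto
        then have "n + 1 < hub 4" using nq i by (simp add: hub_def)
        then show ?thesis by (intro eq) (auto simp: adj_def)
      qed
      have "(q - 1) mod 3 < 3" by simp
      then have "(q - 1) mod 3 = 0 \<or> (q - 1) mod 3 = 1 \<or> (q - 1) mod 3 = 2" by linarith
      then show ?thesis using q 0 h m p by (auto simp: g Let_def)
    qed
  qed
qed

lemma sages_win_hat_graph: "sages_win hat_graph 14"
proof (rule sages_winI)
  fix c :: "nat \<Rightarrow> nat" assume "\<And>v. v \<in> pverts hat_graph \<Longrightarrow> c v < 14"
  then have "\<exists>n < hub 4. hat_guess n c = c n" by (intro hat_guess_wins) (simp add: hat_graph_def)
  then show "\<exists>v \<in> pverts hat_graph. hat_guess v c = c v" by (auto simp: hat_graph_def)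
qed (use hat_guess_cong hat_guess_less in blast)+

theorem theorem6:
  shows "\<exists>G'' :: nat pair_pre_digraph.
    pair_graph G'' \<and> planar G'' \<and> hat_guessing_number G'' \<ge> 14"
  using pair_graph_hat_graph planar_hat_graph
    le_hat_guessing_number[OF pair_graph_hat_graph sages_win_hat_graph] by blast

end
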